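(* Let $R\subset S$ be a u-elementary extension, i.e. there exists $s\in S$ such that $S=R[s]$ with $s^2-s\in R$ and $s^3-s^2\in R$. Then for each $P\in\mathrm{Spec}(R)$, the fiber at $P$ of $R\subset S$, i.e. the set of prime ideals $Q$ of $S$ with $Q\cap R=P$, has at most two elements.
   Context: All rings are commutative with unit. A ring extension $R\subset S$ means that $R$ is a subring of $S$ with the same unit. *)

theory Defs
  imports "HOL-Algebra.Algebra"
begin

text \<open>
  The ring \<open>S\<close> is a record and the base ring of an extension is a subset \<open>R\<close> of its carrier;
  as a ring in its own right it is \<open>S\<lparr>carrier := R\<rparr>\<close>.  The library predicate \<^const>\<open>subring\<close>
  demands the same unit and does not exclude \<open>R = carrier S\<close>.
\<close>

definition ring_extension :: "'a set \<Rightarrow> ('a, 'b) ring_scheme \<Rightarrow> bool" where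
  "ring_extension R S \<longleftrightarrow> cring S \<and> subring R S"

definition u_elementary :: "'a set \<Rightarrow> ('a, 'b) ring_scheme \<Rightarrow> bool" where
  "u_elementary R S \<longleftrightarrow> ring_extension R S \<and>
    (\<exists>s \<in> carrier S. carrier S = generate_ring S (insert s R) \<and>
       s [^]\<^bsub>S\<^esub> (2::nat) \<ominus>\<^bsub>S\<^esub> s \<in> R \<and>
       s [^]\<^bsub>S\<^esub> (3::nat) \<ominus>\<^bsub>S\<^esub> s [^]\<^bsub>S\<^esub> (2::nat) \<in> R)"

definition Spec :: "('a, 'b) ring_scheme \<Rightarrow> 'a set set" where
  "Spec A = {P. primeideal P A}"

definition spec_fiber :: "'a set \<Rightarrow> ('a, 'b) ring_scheme \<Rightarrow> 'a set \<Rightarrow> 'a set set" where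
  "spec_fiber R S P = {Q \<in> Spec S. Q \<inter> R = P}"

end

theory Submission
  imports Defs
begin

text \<open>
  Put \<open>d = s\<^sup>2 - s \<in> R\<close>.  Because \<open>s\<^sup>2 = s + d\<close>, the extension is generated by \<open>1\<close> and \<open>s\<close>
  already as an \<open>R\<close>-module: \<open>S = R + Rs\<close>.  The point is that a prime \<open>Q\<close> over \<open>P\<close> is determined
  by the single bit \<open>s \<in> Q\<close>, which leaves room for only two primes
  (\<open>prime_over_determined_by_generator\<close>).

  If \<open>d \<in> P\<close>, then \<open>s (s - 1) = d \<in> Q\<close>, so \<open>s\<close> is congruent modulo \<open>Q\<close> to some \<open>c \<in> {0, 1}\<close>,
  and the bit says which.  Every \<open>a + bs\<close> is then congruent to the element \<open>a + bc\<close> of \<open>R\<close>,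
  and whether that one lies in \<open>Q\<close> is decided by \<open>P\<close>.

  If \<open>d \<notin> P\<close>, the second condition \<open>ds = s\<^sup>3 - s\<^sup>2 \<in> R\<close> gives \<open>dS \<subseteq> R\<close>, so \<open>d\<close> lies in the
  conductor.  As \<open>d \<notin> Q\<close>, an element \<open>x\<close> lies in \<open>Q\<close> iff \<open>dx\<close> does, iff \<open>dx \<in> P\<close>, so
  here there is at most one \<open>Q\<close>.
\<close>

text \<open>
  The span \<open>K + Ks\<close> is closed under products because \<open>s\<^sup>2\<close> reduces to \<open>s + d\<close> with \<open>d \<in> K\<close>.
\<close>

lemma (in cring) generate_ring_quadratic:
  assumes R: "subring K R" and s: "s \<in> carrier R"
    and d: "s \<otimes> s \<ominus> s \<in> K" and x: "x \<in> generate_ring R (insert s K)"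
  obtains a b where "a \<in> K" "b \<in> K" "x = a \<oplus> b \<otimes> s"
proof -
  note K = subringE[OF R]
  have sub: "a \<in> carrier R" if "a \<in> K" for a using K(1) that by blast
  define d where "d = s \<otimes> s \<ominus> s"
  have dK: "d \<in> K" using d by (simp add: d_def)
  have ss: "s \<otimes> s = s \<oplus> d" unfolding d_def using s by algebra
  from x have "\<exists>a\<in>K. \<exists>b\<in>K. x = a \<oplus> b \<otimes> s"
  proof (induction rule: generate_ring.induct)
    case one
    have "\<one> = \<one> \<oplus> \<zero> \<otimes> s" using s by simp
    then show ?case using K by blast
  next
    case (incl h)
    have "s = \<zero> \<oplus> \<one> \<otimes> s" using s by simp
    moreover have "h = h \<oplus> \<zero> \<otimes> s" if "h \<in> K" using s sub that by simp
    ultimately show ?case using incl K by blast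
  next
    case (a_inv h)
    then obtain a b where ab: "a \<in> K" "b \<in> K" and h: "h = a \<oplus> b \<otimes> s" by blast
    have "\<ominus> h = \<ominus> a \<oplus> (\<ominus> b) \<otimes> s" unfolding h using ab sub s by algebra
    then show ?case using ab K by blast
  next
    case (eng_add h1 h2)
    then obtain a b a' b' where ab: "a \<in> K" "b \<in> K" "a' \<in> K" "b' \<in> K"
      and h: "h1 = a \<oplus> b \<otimes> s" "h2 = a' \<oplus> b' \<otimes> s" by blast
    have "h1 \<oplus> h2 = (a \<oplus> a') \<oplus> (b \<oplus> b') \<otimes> s" unfolding h using ab[THEN sub] s by algebra
    moreover have "a \<oplus> a' \<in> K" "b \<oplus> b' \<in> K" using ab K by simp_all
    ultimately show ?case by blast
  next
    case (eng_mult h1 h2)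
    then obtain a b a' b' where ab: "a \<in> K" "b \<in> K" "a' \<in> K" "b' \<in> K"
      and h: "h1 = a \<oplus> b \<otimes> s" "h2 = a' \<oplus> b' \<otimes> s" by blast
    have "h1 \<otimes> h2 = a \<otimes> a' \<oplus> (a \<otimes> b' \<oplus> b \<otimes> a') \<otimes> s \<oplus> (b \<otimes> b') \<otimes> (s \<otimes> s)"
      unfolding h using ab[THEN sub] s by algebra
    also have "\<dots> = (a \<otimes> a' \<oplus> (b \<otimes> b') \<otimes> d) \<oplus> (a \<otimes> b' \<oplus> b \<otimes> a' \<oplus> b \<otimes> b') \<otimes> s"
      unfolding ss using ab[THEN sub] s sub[OF dK] by algebra
    finally have "h1 \<otimes> h2 = (a \<otimes> a' \<oplus> (b \<otimes> b') \<otimes> d) \<oplus> (a \<otimes> b' \<oplus> b \<otimes> a' \<oplus> b \<otimes> b') \<otimes> s" .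
    moreover have "a \<otimes> a' \<oplus> (b \<otimes> b') \<otimes> d \<in> K" "a \<otimes> b' \<oplus> b \<otimes> a' \<oplus> b \<otimes> b' \<in> K"
      using ab dK K by simp_all
    ultimately show ?case by blast
  qed
  then show thesis using that by blast
qed

text \<open>
  Equal contractions decide membership for elements of \<open>K\<close>.  Every element of the extension is
  congruent to one of \<open>K\<close> modulo both ideals at once, since the same \<open>c\<close> serves for both.
\<close>

lemma (in cring) ideal_subset_if_generator_congruent:
  assumes K: "subring K R" and Q: "ideal Q R" and Q': "ideal Q' R"
    and eq: "Q \<inter> K = Q' \<inter> K"
    and s: "s \<in> carrier R" and c: "c \<in> K" "s \<ominus> c \<in> Q" "s \<ominus> c \<in> Q'"
    and span: "\<And>x. x \<in> carrier R \<Longrightarrow> \<exists>a\<in>K. \<exists>b\<in>K. x = a \<oplus> b \<otimes> s"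
  shows "Q \<subseteq> Q'"
proof
  interpret Q: ideal Q R by (rule Q)
  interpret Q': ideal Q' R by (rule Q')
  note KE = subringE[OF K]
  have sub: "a \<in> carrier R" if "a \<in> K" for a using KE(1) that by blast
  fix x assume x: "x \<in> Q"
  then obtain a b where ab: "a \<in> K" "b \<in> K" and xab: "x = a \<oplus> b \<otimes> s"
    using span Q.Icarr by blast
  define r where "r = a \<oplus> b \<otimes> c"
  have rK: "r \<in> K" unfolding r_def using ab c KE by simp
  have x_r: "x = r \<oplus> b \<otimes> (s \<ominus> c)" and r_x: "r = x \<ominus> b \<otimes> (s \<ominus> c)"
    unfolding xab r_def using ab[THEN sub] sub[OF c(1)] s by algebra+
  have "r \<in> Q" unfolding r_x a_minus_def
    using x Q.I_l_closed[OF c(2) sub[OF ab(2)]]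
    unfolding a_minus_def by (intro Q.a_closed Q.a_inv_closed)
  then have "r \<in> Q'" using rK eq by blast
  then show "x \<in> Q'" unfolding x_r
    using Q'.I_l_closed[OF c(3) sub[OF ab(2)]] by (intro Q'.a_closed)
qed

lemma (in cring) prime_subset_if_conductor:
  assumes Q: "ideal Q R" and Q': "primeideal Q' R" and eq: "Q \<inter> K = Q' \<inter> K"
    and d: "d \<in> carrier R" "d \<notin> Q'" and cond: "\<And>x. x \<in> carrier R \<Longrightarrow> d \<otimes> x \<in> K"
  shows "Q \<subseteq> Q'"
proof
  interpret Q: ideal Q R by (rule Q)
  interpret Q': primeideal Q' R by (rule Q')
  fix x assume x: "x \<in> Q"
  have "d \<otimes> x \<in> Q'" using Q.I_l_closed[OF x d(1)] cond[OF Q.Icarr[OF x]] eq by blast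
  then show "x \<in> Q'" using Q'.I_prime[OF d(1) Q.Icarr[OF x]] d(2) by blast
qed

text \<open>
  Equality of \<open>Q\<close> and \<open>Q'\<close> follows by exchanging them, as the hypotheses are symmetric.  The
  second hypothesis on \<open>s\<close> places \<open>s\<^sup>2 - s\<close> in the conductor, which settles the case where this
  element avoids the primes; otherwise each prime contains \<open>s\<close> or \<open>s - 1\<close>.
\<close>

lemma (in cring) prime_over_determined_by_generator:
  assumes K: "subring K R" and s: "s \<in> carrier R"
    and gen: "carrier R = generate_ring R (insert s K)"
    and d: "s \<otimes> s \<ominus> s \<in> K" and e: "(s \<otimes> s \<ominus> s) \<otimes> s \<in> K"
    and Q: "primeideal Q R" and Q': "primeideal Q' R"
    and eq: "Q \<inter> K = Q' \<inter> K" and bit: "s \<in> Q \<longleftrightarrow> s \<in> Q'"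
  shows "Q \<subseteq> Q'"
proof -
  interpret Q: primeideal Q R by (rule Q)
  interpret Q': primeideal Q' R by (rule Q')
  note KE = subringE[OF K]
  have sub: "a \<in> carrier R" if "a \<in> K" for a using KE(1) that by blast
  define d where "d = s \<otimes> s \<ominus> s"
  have dK: "d \<in> K" and dsK: "d \<otimes> s \<in> K" using d e by (simp_all add: d_def)
  have d_fact: "d = s \<otimes> (s \<ominus> \<one>)" unfolding d_def using s by algebra
  have span: "\<exists>a\<in>K. \<exists>b\<in>K. x = a \<oplus> b \<otimes> s" if "x \<in> carrier R" for x
    using generate_ring_quadratic[OF K s d] gen that by metis
  show ?thesis
  proof (cases "d \<in> Q'")
    case True
    then have dQ: "d \<in> Q" using dK eq by blast
    have root: "s \<in> I \<or> s \<ominus> \<one> \<in> I" if "primeideal I R" "d \<in> I" for I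
      using primeideal.I_prime[OF that(1) s, of "s \<ominus> \<one>"] that(2) s unfolding d_fact by simp
    have "\<exists>c\<in>K. s \<ominus> c \<in> Q \<and> s \<ominus> c \<in> Q'"
    proof (cases "s \<in> Q")
      case True
      have "s \<ominus> \<zero> = s" using s by algebra
      then show ?thesis using True bit KE(2) by metis
    next
      case False
      then show ?thesis using root[OF Q dQ] root[OF Q' True] bit KE(3) by blast
    qed
    then show ?thesis
      using ideal_subset_if_generator_congruent[OF K Q.is_ideal Q'.is_ideal eq s] span by blast
  next
    case False
    have "d \<otimes> x \<in> K" if "x \<in> carrier R" for x
    proof -
      obtain a b where ab: "a \<in> K" "b \<in> K" and x: "x = a \<oplus> b \<otimes> s" using span \<open>x \<in> carrier R\<close> by blast
      have "d \<otimes> x = d \<otimes> a \<oplus> b \<otimes> (d \<otimes> s)"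
        unfolding x using ab[THEN sub] sub[OF dK] s by algebra
      then show ?thesis using ab dK dsK KE by simp
    qed
    then show ?thesis
      by (rule prime_subset_if_conductor[OF Q.is_ideal Q' eq sub[OF dK] False])
  qed
qed

theorem proposition7p6:
  fixes R :: "'a set" and S :: "('a, 'b) ring_scheme"
  assumes "u_elementary R S"
  shows "\<forall>P \<in> Spec (S\<lparr>carrier := R\<rparr>).
           finite (spec_fiber R S P) \<and> card (spec_fiber R S P) \<le> 2"
proof
  fix P assume "P \<in> Spec (S\<lparr>carrier := R\<rparr>)"
  from assms have "cring S" and R: "subring R S"
    unfolding u_elementary_def ring_extension_def by auto
  interpret S: cring S by fact
  from assms obtain s where s: "s \<in> carrier S" and gen: "carrier S = generate_ring S (insert s R)"
    and s2: "s [^]\<^bsub>S\<^esub> (2::nat) \<ominus>\<^bsub>S\<^esub> s \<in> R"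
    and s3: "s [^]\<^bsub>S\<^esub> (3::nat) \<ominus>\<^bsub>S\<^esub> s [^]\<^bsub>S\<^esub> (2::nat) \<in> R"
    unfolding u_elementary_def by blast
  have d: "s \<otimes>\<^bsub>S\<^esub> s \<ominus>\<^bsub>S\<^esub> s \<in> R"
    using s2 s by (simp add: numeral_2_eq_2)
  have "s [^]\<^bsub>S\<^esub> (3::nat) \<ominus>\<^bsub>S\<^esub> s [^]\<^bsub>S\<^esub> (2::nat) = (s \<otimes>\<^bsub>S\<^esub> s \<ominus>\<^bsub>S\<^esub> s) \<otimes>\<^bsub>S\<^esub> s"
    using s by (simp add: numeral_2_eq_2 numeral_3_eq_3) algebra
  with s3 have e: "(s \<otimes>\<^bsub>S\<^esub> s \<ominus>\<^bsub>S\<^esub> s) \<otimes>\<^bsub>S\<^esub> s \<in> R" by simp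
  let ?F = "spec_fiber R S P"
  have inj: "inj_on (\<lambda>Q. s \<in> Q) ?F"
  proof (rule inj_onI)
    fix Q Q' assume "Q \<in> ?F" "Q' \<in> ?F" and bit: "(s \<in> Q) = (s \<in> Q')"
    then have Q: "primeideal Q S" "primeideal Q' S" and eq: "Q \<inter> R = Q' \<inter> R"
      by (auto simp: spec_fiber_def Spec_def)
    show "Q = Q'"
      using S.prime_over_determined_by_generator[OF R s gen d e Q eq bit]
        S.prime_over_determined_by_generator[OF R s gen d e Q(2,1) eq[symmetric] bit[symmetric]]
      by (rule subset_antisym)
  qed
  have "finite ?F" using inj by (rule inj_on_finite[of _ _ UNIV]) auto
  moreover have "card ?F \<le> card (UNIV :: bool set)" using inj by (rule card_inj_on_le) auto
  ultimately show "finite ?F \<and> card ?F \<le> 2" by simp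
qed

end
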